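(* Let $\mathbf{x}=\begin{pmatrix} x_1 \\ x_2 \end{pmatrix}$ be a point in $\mathbb{R}^2$ with irrational slope $x_1/x_2$, and let $\Gamma=\mathrm{SL}(2,\mathbb{Z})$. (i) There exist infinitely many matrices $\gamma\in\Gamma$ such that $$|\gamma\mathbf{x}|\le \frac{|\mathbf{x}|}{|\gamma|}.$$ (ii) Let $\mathbf{y}=\begin{pmatrix} y_1 \\ y_2 \end{pmatrix}\in\mathbb{R}^2\setminus\{\mathbf{0}\}$. Assume that either $y_2\neq 0$ and the slope $y_1/y_2$ is a rational number $a/b$ (with $a,b$ integers, $b\ne 0$), or that $y_2=0$, in which case put $a=1$ and $b=0$. Then there exist infinitely many matrices $\gamma\in\Gamma$ such that $$|\gamma\mathbf{x}-\mathbf{y}|\le\frac{c}{|\gamma|^{1/2}}\quad\text{with}\quad c=2\sqrt{3}\,\max(|a|,|b|)\,|\mathbf{x}|^{1/2}|\mathbf{y}|^{1/2}.$$ (iii) Let $\mathbf{y}=\begin{pmatrix} y_1 \\ y_2 \end{pmatrix}\in\mathbb{R}^2$ be a point whose slope $y_1/y_2$ is irrational. Then there exist infinitely many matrices $\gamma\in\Gamma$ such that $$|\gamma\mathbf{x}-\mathbf{y}|\le\frac{c'}{|\gamma|^{1/3}}\quad\text{with}\quad c'=7\sqrt{5}\,|\mathbf{x}|^{1/3}|\mathbf{y}|^{2/3}.$$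
   Context: $\Gamma=\mathrm{SL}(2,\mathbb{Z})$ acts on column vectors of $\mathbb{R}^2$ by left multiplication. For $\mathbf{z}=\begin{pmatrix} z_1 \\ z_2 \end{pmatrix}\in\mathbb{R}^2$, $|\mathbf{z}|=\max(|z_1|,|z_2|)$, and the slope of $\mathbf{z}$ is $z_1/z_2$ (when $z_2\ne0$). For a matrix $\gamma$, $|\gamma|$ is the maximum of the absolute values of its entries. $\mathbf{0}$ denotes the origin of $\mathbb{R}^2$. *)

theory Defs
  imports "HOL-Analysis.Analysis"
begin

(* SL(2,Z), as real matrices with integer entries, so that it acts on real^2 by *v. *)
definition SL2Z :: "(real^2^2) set" where
  "SL2Z = {A. (\<forall>i j. A $ i $ j \<in> \<int>) \<and> det A = 1}"

definition slope :: "real^2 \<Rightarrow> real" where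
  "slope z = z $ 1 / z $ 2"

(* The explicit z $ 2 \<noteq> 0 keeps this from relying on the convention that division by 0 gives 0. *)
definition irrational_slope :: "real^2 \<Rightarrow> bool" where
  "irrational_slope z \<longleftrightarrow> z $ 2 \<noteq> 0 \<and> slope z \<notin> \<rat>"

(* infnorm is the maximum norm both on vectors and (entrywise) on matrices. *)
lemma infnorm_vec2: "infnorm (z :: real^2) = max \<bar>z $ 1\<bar> \<bar>z $ 2\<bar>"
proof -
  have "{\<bar>z $ i\<bar> |i. i \<in> (UNIV :: 2 set)} = {\<bar>z $ 1\<bar>, \<bar>z $ 2\<bar>}"
    by (auto simp: UNIV_2)
  then show ?thesis
    by (simp add: infnorm_cart cSup_eq_Max)
qed

lemma infnorm_mat2:
  "infnorm (A :: real^2^2) = Max {\<bar>A $ 1 $ 1\<bar>, \<bar>A $ 1 $ 2\<bar>, \<bar>A $ 2 $ 1\<bar>, \<bar>A $ 2 $ 2\<bar>}"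
proof -
  have B: "(Basis :: (real^2^2) set) = (\<Union>i. \<Union>j. {axis i (axis j 1)})"
    by (auto simp: Basis_vec_def)
  have "{\<bar>A \<bullet> b\<bar> |b. b \<in> Basis} = (\<lambda>b. \<bar>A \<bullet> b\<bar>) ` Basis"
    by auto
  also have "\<dots> = {\<bar>A $ 1 $ 1\<bar>, \<bar>A $ 1 $ 2\<bar>, \<bar>A $ 2 $ 1\<bar>, \<bar>A $ 2 $ 2\<bar>}"
    unfolding B by (auto simp: UNIV_2 inner_axis)
  finally show ?thesis
    by (simp add: infnorm_def cSup_eq_Max)
qed

end

theory Submission
  imports Defs
begin

text \<open>
  Running Euclid's algorithm on the coordinates of \<open>x\<close> yields primitive integer rows \<open>s\<^sub>k\<close> of norm
  \<open>q\<^sub>k\<close> with \<open>e\<^sub>k = \<bar>s\<^sub>k x\<bar>\<close> between \<open>\<bar>x\<bar> / (2 q\<^sub>k\<^sub>+\<^sub>1)\<close> and \<open>\<bar>x\<bar> / q\<^sub>k\<^sub>+\<^sub>1\<close>, consecutive rows having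
  determinant \<open>\<plusminus>1\<close>.  Stacking \<open>s\<^sub>k\<^sub>+\<^sub>1\<close> and \<open>s\<^sub>k\<close> gives (i).

  Given a primitive column \<open>(a, b)\<close> of norm \<open>H\<close>, complete it to \<open>N \<in> SL(2,\<int>)\<close> with entries bounded by \<open>H\<close>,
  and let \<open>\<gamma>\<close> be \<open>N\<close> times the matrix with rows \<open>\<plusminus>s\<^sub>k\<^sub>+\<^sub>1 + l s\<^sub>k\<close> and \<open>s\<^sub>k\<close>.  A suitable \<open>l\<close> brings \<open>\<gamma>x\<close>
  within \<open>2He\<^sub>k\<close> of \<open>\<mu>(a, b)\<close>, with \<open>\<bar>\<gamma>\<bar> \<le> H(4q\<^sub>k\<^sub>+\<^sub>1 + q\<^sub>k\<bar>\<mu>\<bar>/e\<^sub>k)\<close>.  A target \<open>y\<close> of rational slope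
  is itself such a multiple, whence (ii).  For irrational slope take \<open>(a, b)\<close> from the rows of norm \<open>Q\<^sub>j\<close>
  attached to \<open>y\<close>: some multiple of it is within \<open>\<bar>y\<bar> / (Q\<^sub>j Q\<^sub>j\<^sub>+\<^sub>1)\<close> of \<open>y\<close>, and the two errors balance when
  \<open>q\<^sub>k \<bar>y\<bar> < Q\<^sub>j\<^sup>3 \<bar>x\<bar> \<le> q\<^sub>k\<^sub>+\<^sub>1 \<bar>y\<bar> < Q\<^sub>j\<^sub>+\<^sub>1\<^sup>3 \<bar>x\<bar>\<close>.  Such \<open>j\<close>, \<open>k\<close> exist arbitrarily far out,
  because two sequences tending to infinity interlace infinitely often.
\<close>

section \<open>Integer rows nearly orthogonal to a vector\<close>

text \<open>Up to signs and exchange of the coordinates, \<open>-v k / u k\<close> runs through the convergents of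
  \<open>\<alpha> / \<beta>\<close>.  The absolute values and maxima make the notion invariant under these symmetries.\<close>

definition approx_seq :: "real \<Rightarrow> real \<Rightarrow> (nat \<Rightarrow> int) \<Rightarrow> (nat \<Rightarrow> int) \<Rightarrow> bool" where
  "approx_seq \<alpha> \<beta> u v \<longleftrightarrow> (\<forall>k.
     \<bar>u (Suc k) * v k - u k * v (Suc k)\<bar> = 1 \<and>
     int k \<le> max \<bar>u k\<bar> \<bar>v k\<bar> \<and> 0 < max \<bar>u k\<bar> \<bar>v k\<bar> \<and>
     max \<bar>u k\<bar> \<bar>v k\<bar> \<le> max \<bar>u (Suc k)\<bar> \<bar>v (Suc k)\<bar> \<and>
     0 < \<bar>u (Suc k) * \<alpha> + v (Suc k) * \<beta>\<bar> \<and>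
     \<bar>u (Suc k) * \<alpha> + v (Suc k) * \<beta>\<bar> < \<bar>u k * \<alpha> + v k * \<beta>\<bar> \<and>
     max \<bar>u (Suc k)\<bar> \<bar>v (Suc k)\<bar> * \<bar>u k * \<alpha> + v k * \<beta>\<bar> \<le> max \<bar>\<alpha>\<bar> \<bar>\<beta>\<bar>)"

lemma approx_seq_swap: "approx_seq \<alpha> \<beta> u v \<Longrightarrow> approx_seq \<beta> \<alpha> v u"
  unfolding approx_seq_def by (simp add: max.commute add.commute mult.commute abs_minus_commute)

lemma approx_seq_minus: "approx_seq (-\<alpha>) \<beta> u v \<Longrightarrow> approx_seq \<alpha> \<beta> (\<lambda>k. - u k) v"
  unfolding approx_seq_def by (simp add: abs_minus_commute)

lemma irrational_comb_nonzero:
  fixes \<alpha> \<beta> :: real and p q :: int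
  assumes "\<alpha> / \<beta> \<notin> \<rat>" "q \<noteq> 0"
  shows "q * \<alpha> \<noteq> p * \<beta>"
proof
  assume "q * \<alpha> = p * \<beta>"
  moreover have "\<beta> \<noteq> 0" using assms(1) by auto
  ultimately have "\<alpha> / \<beta> = p / q" using assms(2) by (simp add: field_simps)
  then show False using assms(1) by simp
qed

section \<open>Euclid's algorithm on a pair of reals\<close>

text \<open>Intended reading: \<open>p/q\<close> and \<open>p'/q'\<close> are consecutive
  convergents of \<alpha>/\<beta>. Since \<open>q = q'\<close> can occur at the start, the strict
  bound \<open>int k < q'\<close> is carried along to guarantee growth.\<close>

definition euclid_inv :: "real \<Rightarrow> real \<Rightarrow> nat \<Rightarrow> int \<times> int \<times> int \<times> int \<Rightarrow> bool" where
  "euclid_inv \<alpha> \<beta> k = (\<lambda>(q, p, q', p').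
     0 < q \<and> int k \<le> q \<and> int k < q' \<and> q \<le> q' \<and> 0 \<le> p \<and> p \<le> q \<and> 0 \<le> p' \<and> p' \<le> q' \<and>
     \<bar>q' * p - q * p'\<bar> = 1 \<and>
     (q * \<alpha> - p * \<beta>) * (q' * \<alpha> - p' * \<beta>) < 0 \<and> \<bar>q' * \<alpha> - p' * \<beta>\<bar> < \<bar>q * \<alpha> - p * \<beta>\<bar>)"

text \<open>The new row is the older one plus \<open>a\<close> times the newer one, \<open>a\<close>
  being the partial quotient. As the residuals have opposite signs, the new residual is the
  remainder of \<open>\<bar>d\<bar>\<close> modulo \<open>\<bar>d'\<bar>\<close>, with the sign of
  \<open>d\<close>; irrationality keeps it away from 0.\<close>

lemma euclid_step:
  assumes irr: "\<alpha> / \<beta> \<notin> \<rat>" and "euclid_inv \<alpha> \<beta> k (q, p, q', p')"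
  shows "\<exists>q'' p''. euclid_inv \<alpha> \<beta> (Suc k) (q', p', q'', p'')"
proof -
  define d d' where "d = q * \<alpha> - p * \<beta>" and "d' = q' * \<alpha> - p' * \<beta>"
  have P: "0 < q" "int k \<le> q" "int k < q'" "q \<le> q'" "0 \<le> p" "p \<le> q" "0 \<le> p'" "p' \<le> q'"
     "\<bar>q' * p - q * p'\<bar> = 1" "d * d' < 0" "\<bar>d'\<bar> < \<bar>d\<bar>"
    using assms(2) by (auto simp: euclid_inv_def d_def d'_def)
  define a where "a = \<lfloor>\<bar>d\<bar> / \<bar>d'\<bar>\<rfloor>"
  have d'0: "d' \<noteq> 0" using P by auto
  have a1: "1 \<le> a" using P d'0 by (simp add: a_def)
  have a_le: "a * \<bar>d'\<bar> \<le> \<bar>d\<bar>"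
    using of_int_floor_le[of "\<bar>d\<bar> / \<bar>d'\<bar>"] d'0 unfolding a_def[symmetric] by (simp add: field_simps)
  have a_gt: "\<bar>d\<bar> < (a + 1) * \<bar>d'\<bar>"
    using floor_correct[of "\<bar>d\<bar> / \<bar>d'\<bar>"] d'0 unfolding a_def[symmetric] by (simp add: field_simps)
  have d'': "(q + a * q') * \<alpha> - (p + a * p') * \<beta> = d + a * d'"
    by (simp add: d_def d'_def algebra_simps)
  have aq: "q' \<le> a * q'" using a1 P by (simp add: mult_le_cancel_right1)
  have ap: "0 \<le> a * p'" "a * p' \<le> a * q'" using a1 P by (simp_all add: mult_left_mono)
  have "d + a * d' \<noteq> 0"
  proof -
    have "q + a * q' \<noteq> 0" using aq P by linarith
    from irrational_comb_nonzero[OF irr this, of "p + a * p'"] show ?thesis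
      using d'' by simp
  qed
  moreover have "d > 0 \<and> d' < 0 \<or> d < 0 \<and> d' > 0" using P(10) by (auto simp: mult_less_0_iff)
  ultimately have "d > 0 \<and> d' < 0 \<and> d + a * d' > 0 \<or> d < 0 \<and> d' > 0 \<and> d + a * d' < 0"
    using a_le by auto
  then have s: "d' * (d + a * d') < 0" "\<bar>d + a * d'\<bar> < \<bar>d'\<bar>"
    using a_gt by (auto simp: mult_less_0_iff distrib_right)
  have "(q + a * q') * p' - q' * (p + a * p') = - (q' * p - q * p')"
    by (simp add: algebra_simps)
  then have "\<bar>(q + a * q') * p' - q' * (p + a * p')\<bar> = 1"
    using P(9) by simp
  then have "euclid_inv \<alpha> \<beta> (Suc k) (q', p', q + a * q', p + a * p')"
    unfolding euclid_inv_def prod.case d'' d'_def[symmetric] using P s aq ap by linarith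
  then show ?thesis by blast
qed

lemma approx_seq_exists_pos:
  assumes irr: "\<alpha> / \<beta> \<notin> \<rat>" and "0 < \<alpha>" "\<alpha> < \<beta>"
  shows "\<exists>u v. approx_seq \<alpha> \<beta> u v"
proof -
  define a where "a = \<lfloor>\<beta> / \<alpha>\<rfloor>"
  have a1: "1 \<le> a" using assms by (simp add: a_def)
  have a_le: "a * \<alpha> \<le> \<beta>"
    using of_int_floor_le[of "\<beta> / \<alpha>"] assms unfolding a_def[symmetric] by (simp add: field_simps)
  have a_gt: "\<beta> < (a + 1) * \<alpha>"
    using floor_correct[of "\<beta> / \<alpha>"] assms unfolding a_def[symmetric] by (simp add: field_simps)
  have "a * \<alpha> \<noteq> 1 * \<beta>" using irrational_comb_nonzero[OF irr, of a 1] a1 by simp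
  \<comment> \<open>The starting residuals are \<alpha> and \<open>a * \<alpha> - \<beta>\<close>;
    the choice of \<open>a\<close> puts the latter strictly between \<open>-\<alpha>\<close> and
    0.\<close>
  then have "euclid_inv \<alpha> \<beta> 0 (1, 0, a, 1)"
    using a1 a_le a_gt assms by (auto simp: euclid_inv_def mult_less_0_iff algebra_simps)
  then have "\<exists>s. euclid_inv \<alpha> \<beta> 0 s" by blast
  \<comment> \<open>Successive states overlap in one pair, so that they glue to a single sequence of
    pairs \<open>(q k, p k)\<close>.\<close>
  moreover have "\<exists>s'. euclid_inv \<alpha> \<beta> (Suc k) s' \<and> (fst s', fst (snd s')) = snd (snd s)"
    if "euclid_inv \<alpha> \<beta> k s" for k s
    using euclid_step[OF irr] that by (cases s) fastforce
  ultimately obtain s where s: "\<And>k. euclid_inv \<alpha> \<beta> k (s k)"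
      "\<And>k. (fst (s (Suc k)), fst (snd (s (Suc k)))) = snd (snd (s k))"
    using dependent_nat_choice[of "euclid_inv \<alpha> \<beta>" "\<lambda>k s s'. (fst s', fst (snd s')) = snd (snd s)"]
    by metis
  define q p where "q k = fst (s k)" and "p k = fst (snd (s k))" for k
  have inv: "euclid_inv \<alpha> \<beta> k (q k, p k, q (Suc k), p (Suc k))" for k
    using s(1)[of k] s(2)[of k] by (simp add: q_def p_def)
  have mx: "max \<bar>q k\<bar> \<bar>- p k\<bar> = q k" for k
    using inv[of k] by (auto simp: euclid_inv_def)
  \<comment> \<open>By the determinant, \<open>q (Suc k) * d - q k * d'\<close> is \<beta> up to
    sign. As \<open>d\<close> and \<open>d'\<close> have opposite signs, the two terms add up in
    absolute value, so the first is at most \<beta>.\<close>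
  have gap: "q (Suc k) * \<bar>q k * \<alpha> - p k * \<beta>\<bar> \<le> \<beta>" for k
  proof -
    define d d' where "d = q k * \<alpha> - p k * \<beta>" and "d' = q (Suc k) * \<alpha> - p (Suc k) * \<beta>"
    have *: "q k > 0" "q (Suc k) > 0" "d * d' < 0" "\<bar>q (Suc k) * p k - q k * p (Suc k)\<bar> = 1"
      using inv[of k] by (auto simp: euclid_inv_def d_def d'_def)
    have "q (Suc k) * d - q k * d' = - of_int (q (Suc k) * p k - q k * p (Suc k)) * \<beta>"
      by (simp add: d_def d'_def algebra_simps)
    then have "\<bar>q (Suc k) * d - q k * d'\<bar> = of_int \<bar>q (Suc k) * p k - q k * p (Suc k)\<bar> * \<beta>"
      using assms by (simp add: abs_mult)
    then have eq: "\<bar>q (Suc k) * d - q k * d'\<bar> = \<beta>"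
      unfolding *(4) by simp
    have "q (Suc k) * \<bar>d\<bar> \<le> \<bar>q (Suc k) * d - q k * d'\<bar>"
    proof (cases "d > 0")
      case True
      then have "d' < 0" using * by (auto simp: mult_less_0_iff)
      then have "q k * d' < 0" using * by (simp add: mult_less_0_iff)
      then show ?thesis using True by simp
    next
      case False
      then have "d' > 0" using * by (auto simp: mult_less_0_iff)
      then have "q k * d' > 0" using * by simp
      then show ?thesis using False by simp
    qed
    then show ?thesis using eq by (simp add: d_def)
  qed
  have "approx_seq \<alpha> \<beta> q (\<lambda>k. - p k)"
    unfolding approx_seq_def mx
  proof (intro allI conjI)
    fix k
    note I = inv[of k, unfolded euclid_inv_def prod.case]
    show "\<bar>q (Suc k) * - p k - q k * - p (Suc k)\<bar> = 1" using I by auto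
    show "int k \<le> q k" "0 < q k" "q k \<le> q (Suc k)" using I by auto
    have n: "q (Suc k) * \<alpha> - p (Suc k) * \<beta> \<noteq> 0" using I by auto
    show "0 < \<bar>q (Suc k) * \<alpha> + (- p (Suc k)) * \<beta>\<bar>" using n by simp
    show "\<bar>q (Suc k) * \<alpha> + (- p (Suc k)) * \<beta>\<bar> < \<bar>q k * \<alpha> + (- p k) * \<beta>\<bar>"
      using I by simp
    show "q (Suc k) * \<bar>q k * \<alpha> + (- p k) * \<beta>\<bar> \<le> max \<bar>\<alpha>\<bar> \<bar>\<beta>\<bar>"
      using gap[of k] assms by simp
  qed
  then show ?thesis by blast
qed

text \<open>Exchanging coordinates and changing signs reduces this to
  \<open>0 < \<alpha> < \<beta>\<close>; equal absolute values would make the quotient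
  rational.\<close>

lemma approx_seq_exists:
  assumes irr: "\<alpha> / \<beta> \<notin> \<rat>"
  shows "\<exists>u v. approx_seq \<alpha> \<beta> u v"
proof -
  have nz: "\<alpha> \<noteq> 0" "\<beta> \<noteq> 0" using irr by auto
  have irr': "\<bar>\<alpha>\<bar> / \<bar>\<beta>\<bar> \<notin> \<rat>" "\<bar>\<beta>\<bar> / \<bar>\<alpha>\<bar> \<notin> \<rat>"
  proof -
    show 1: "\<bar>\<alpha>\<bar> / \<bar>\<beta>\<bar> \<notin> \<rat>"
      using irr by (metis Rats_abs_iff abs_divide)
    show "\<bar>\<beta>\<bar> / \<bar>\<alpha>\<bar> \<notin> \<rat>"
      using 1 Rats_inverse[of "\<bar>\<beta>\<bar> / \<bar>\<alpha>\<bar>"] by auto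
  qed
  have "\<bar>\<alpha>\<bar> \<noteq> \<bar>\<beta>\<bar>" using irr' nz by auto
  then have "\<exists>u v. approx_seq \<bar>\<alpha>\<bar> \<bar>\<beta>\<bar> u v"
    using approx_seq_exists_pos[OF irr'(1)] approx_seq_exists_pos[OF irr'(2)] approx_seq_swap nz
    by (metis linorder_neqE_linordered_idom zero_less_abs_iff)
  then have "\<exists>u v. approx_seq \<alpha> \<bar>\<beta>\<bar> u v"
    using approx_seq_minus by (metis abs_if)
  then show ?thesis
    using approx_seq_minus approx_seq_swap by (metis abs_if)
qed

section \<open>Size and growth of the rows\<close>

lemma approx_seqD:
  fixes n :: "nat \<Rightarrow> int" and e :: "nat \<Rightarrow> real"
  assumes "approx_seq \<alpha> \<beta> u v"
  defines "n \<equiv> \<lambda>k. max \<bar>u k\<bar> \<bar>v k\<bar>" and "e \<equiv> \<lambda>k. \<bar>u k * \<alpha> + v k * \<beta>\<bar>"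
  shows "\<bar>u (Suc k) * v k - u k * v (Suc k)\<bar> = 1" "int k \<le> n k" "1 \<le> n k" "n k \<le> n (Suc k)"
    "0 < e k" "e (Suc k) < e k" "n (Suc k) * e k \<le> max \<bar>\<alpha>\<bar> \<bar>\<beta>\<bar>"
proof -
  note I = assms(1)[unfolded approx_seq_def, rule_format, of k]
  show "\<bar>u (Suc k) * v k - u k * v (Suc k)\<bar> = 1" "int k \<le> n k" "1 \<le> n k" "n k \<le> n (Suc k)"
    "e (Suc k) < e k" "n (Suc k) * e k \<le> max \<bar>\<alpha>\<bar> \<bar>\<beta>\<bar>"
    using I unfolding n_def e_def int_one_le_iff_zero_less by blast+
  show "0 < e k" using I unfolding e_def by (blast intro: less_trans)
qed

text \<open>Row \<open>k + 1\<close> has norm at least \<open>k + 1\<close>, so the residual of row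
  \<open>k\<close> is at most \<open>X / (k + 1)\<close>.\<close>

lemma approx_seq_small:
  assumes "approx_seq \<alpha> \<beta> u v" "0 < \<eta>"
  shows "\<exists>k. \<bar>u k * \<alpha> + v k * \<beta>\<bar> < \<eta>"
proof -
  define X where "X = max \<bar>\<alpha>\<bar> \<bar>\<beta>\<bar>"
  obtain k :: nat where "X / \<eta> < k" using reals_Archimedean2 by blast
  then have k: "X < (k + 1) * \<eta>" using assms(2) by (simp add: field_simps)
  define e n where "e = \<bar>u k * \<alpha> + v k * \<beta>\<bar>" and "n = max \<bar>u (Suc k)\<bar> \<bar>v (Suc k)\<bar>"
  have "n * e \<le> X" "int (Suc k) \<le> n" "0 < e"
    using approx_seqD[OF assms(1)] unfolding e_def n_def X_def by blast+
  then have "real (k + 1) * e \<le> n * e" by (intro mult_right_mono) linarith+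
  then have "(k + 1) * e \<le> X" using \<open>n * e \<le> X\<close> by linarith
  then have "(k + 1) * e < (k + 1) * \<eta>" using k by linarith
  then have "e < \<eta>" by (simp add: mult_less_cancel_left_pos)
  then show ?thesis unfolding e_def by blast
qed

text \<open>Cramer's rule: as the determinant is 1 or -1, \<alpha> and \<beta> are, up to sign,
  combinations of two consecutive residuals whose coefficients are entries of the rows. Every
  coefficient is at most \<open>n'\<close> and every residual at most
  \<open>\<bar>d\<bar>\<close>.\<close>

lemma approx_seq_gap_lower:
  assumes "approx_seq \<alpha> \<beta> u v"
  shows "max \<bar>\<alpha>\<bar> \<bar>\<beta>\<bar> \<le> 2 * (max \<bar>u (Suc k)\<bar> \<bar>v (Suc k)\<bar> * \<bar>u k * \<alpha> + v k * \<beta>\<bar>)"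
proof -
  define n n' where "n = max \<bar>u k\<bar> \<bar>v k\<bar>" and "n' = max \<bar>u (Suc k)\<bar> \<bar>v (Suc k)\<bar>"
  define d d' where "d = u k * \<alpha> + v k * \<beta>" and "d' = u (Suc k) * \<alpha> + v (Suc k) * \<beta>"
  define D where "D = u (Suc k) * v k - u k * v (Suc k)"
  have I: "\<bar>D\<bar> = 1" "n \<le> n'" "\<bar>d'\<bar> < \<bar>d\<bar>"
    using assms unfolding approx_seq_def n_def n'_def d_def d'_def D_def by blast+
  have n: "real_of_int \<bar>u k\<bar> \<le> n'" "real_of_int \<bar>v k\<bar> \<le> n'"
      "real_of_int \<bar>u (Suc k)\<bar> \<le> n'" "real_of_int \<bar>v (Suc k)\<bar> \<le> n'"
    using I(2) unfolding n_def n'_def of_int_le_iff by auto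
  have "\<bar>z' * d - z * d'\<bar> \<le> 2 * (n' * \<bar>d\<bar>)" if "\<bar>z\<bar> \<le> n'" "\<bar>z'\<bar> \<le> n'" for z z' :: real
  proof -
    have "\<bar>z' * d - z * d'\<bar> \<le> \<bar>z'\<bar> * \<bar>d\<bar> + \<bar>z\<bar> * \<bar>d'\<bar>"
      using abs_triangle_ineq4[of "z' * d" "z * d'"] by (simp add: abs_mult)
    also have "\<dots> \<le> n' * \<bar>d\<bar> + n' * \<bar>d\<bar>"
      using that I(3) by (intro add_mono mult_mono) auto
    finally show ?thesis by linarith
  qed
  from this[of "u k" "u (Suc k)"] this[of "v k" "v (Suc k)"] n
  have *: "\<bar>u (Suc k) * d - u k * d'\<bar> \<le> 2 * (n' * \<bar>d\<bar>)" "\<bar>v (Suc k) * d - v k * d'\<bar> \<le> 2 * (n' * \<bar>d\<bar>)"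
    by simp_all
  have "u (Suc k) * d - u k * d' = D * \<beta>" "v (Suc k) * d - v k * d' = - D * \<alpha>"
    by (simp_all add: d_def d'_def D_def algebra_simps)
  moreover have "\<bar>real_of_int D\<bar> = 1" using I(1) by linarith
  ultimately have "\<bar>\<beta>\<bar> \<le> 2 * (n' * \<bar>d\<bar>)" "\<bar>\<alpha>\<bar> \<le> 2 * (n' * \<bar>d\<bar>)"
    using * by (simp_all add: abs_mult)
  then show ?thesis by (simp add: n'_def d_def)
qed

lemma approx_seq_filterlim:
  assumes "approx_seq \<alpha> \<beta> u v" "0 < t"
  shows "filterlim (\<lambda>k. t * real_of_int (max \<bar>u k\<bar> \<bar>v k\<bar>)) at_top sequentially"
proof (rule filterlim_tendsto_pos_mult_at_top[OF tendsto_const assms(2)])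
  have "real k \<le> real_of_int (max \<bar>u k\<bar> \<bar>v k\<bar>)" for k
    using approx_seqD(2)[OF assms(1), of k] by linarith
  then show "filterlim (\<lambda>k. real_of_int (max \<bar>u k\<bar> \<bar>v k\<bar>)) at_top sequentially"
    by (intro filterlim_at_top_mono[OF filterlim_real_sequentially]) auto
qed

section \<open>Points of the orbit near a multiple of an integer vector\<close>

text \<open>Start from \<open>f j1 > g 0\<close>. Let \<open>K\<close> be the first index where
  \<open>g\<close> reaches \<open>f j1\<close>, and \<open>J\<close> the first where
  \<open>f\<close> exceeds \<open>g K\<close>. Their predecessors serve, since
  \<open>g k < f j1 \<le> f j\<close>.\<close>

lemma exists_interlacing:
  fixes f g :: "nat \<Rightarrow> real"
  assumes "mono f" "filterlim f at_top at_top" "filterlim g at_top at_top"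
  shows "\<exists>j k. j0 \<le> j \<and> g k < f j \<and> f j \<le> g (Suc k) \<and> g (Suc k) < f (Suc j)"
proof -
  have unb: "\<exists>n\<ge>m. h n > c" if "filterlim h at_top at_top" for h :: "nat \<Rightarrow> real" and m c
    using that unfolding filterlim_at_top_dense eventually_sequentially by (meson nle_le)
  obtain j1 where j1: "j1 \<ge> j0" "f j1 > g 0" using unb[OF assms(2)] by blast
  define K where "K = (LEAST k. f j1 \<le> g k)"
  have "\<exists>k. f j1 \<le> g k" using unb[OF assms(3)] less_imp_le by blast
  then have K: "f j1 \<le> g K" "\<And>k. k < K \<Longrightarrow> g k < f j1"
    unfolding K_def by (auto intro: LeastI_ex dest: not_less_Least)
  then obtain k where k: "K = Suc k" using j1 by (cases K) auto
  define J where "J = (LEAST j. g K < f j)"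
  have "\<exists>j. g K < f j" using unb[OF assms(2)] by blast
  then have J: "g K < f J" "\<And>j. j < J \<Longrightarrow> f j \<le> g K"
    unfolding J_def by (auto intro: LeastI_ex dest: not_less_Least)
  have "j1 < J" using J(1) K(1) monoD[OF assms(1)] by (meson leD leI le_less_trans)
  then obtain j where j: "J = Suc j" "j1 \<le> j" by (cases J) auto
  then have "g k < f j" using K(2)[of k] k monoD[OF assms(1) j(2)] by simp
  then show ?thesis using j j1 J k by (intro exI[of _ j] exI[of _ k]) auto
qed

text \<open>Reducing the Bezout coefficient \<open>d\<close> modulo \<open>\<bar>b\<bar>\<close>
  bounds \<open>c\<close> as well, because \<open>b * c = a * d - 1\<close>.\<close>

lemma coprime_completion:
  fixes a b :: int
  assumes "coprime a b"
  shows "\<exists>c d. a * d - b * c = 1 \<and> \<bar>c\<bar> \<le> max \<bar>a\<bar> \<bar>b\<bar> \<and> \<bar>d\<bar> \<le> max \<bar>a\<bar> \<bar>b\<bar>"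
proof (cases "b = 0")
  case True
  then have "\<bar>a\<bar> = 1" using assms by simp
  then have "a * a - b * 0 = 1" by (auto simp: abs_if split: if_splits)
  then show ?thesis using True by (intro exI[of _ 0] exI[of _ a]) auto
next
  case False
  obtain d0 c0 where "d0 * a + c0 * b = 1" using assms bezout_int[of a b] by auto
  define d where "d = d0 mod \<bar>b\<bar>"
  have "b dvd d - d0" unfolding d_def by (metis abs_dvd_iff mod_eq_dvd_iff mod_mod_trivial)
  then have "b dvd a * (d - d0) - c0 * b" by simp
  also have "a * (d - d0) - c0 * b = a * d - 1"
    using \<open>d0 * a + c0 * b = 1\<close> by (simp add: algebra_simps)
  finally obtain c where c: "a * d - 1 = b * c" by (auto simp: dvd_def)
  have d: "0 \<le> d" "d < \<bar>b\<bar>" using False by (auto simp: d_def)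
  \<comment> \<open>The maximum with 1 covers \<open>a = 0\<close>, where
    \<open>\<bar>c\<bar> = 1\<close>.\<close>
  have "\<bar>b\<bar> * \<bar>c\<bar> \<le> \<bar>b\<bar> * max \<bar>a\<bar> 1"
  proof -
    have "\<bar>b\<bar> * \<bar>c\<bar> \<le> \<bar>a\<bar> * d + 1" using d c abs_mult[of b c] abs_mult[of a d] by linarith
    also have "\<dots> \<le> max \<bar>a\<bar> 1 * d + max \<bar>a\<bar> 1"
      using d by (intro add_mono mult_right_mono) auto
    also have "\<dots> = max \<bar>a\<bar> 1 * (d + 1)" by (simp add: algebra_simps)
    also have "\<dots> \<le> max \<bar>a\<bar> 1 * \<bar>b\<bar>" using d by (intro mult_left_mono) auto
    finally show ?thesis by (simp add: mult.commute)
  qed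
  then have "\<bar>c\<bar> \<le> max \<bar>a\<bar> 1" using False by simp
  then show ?thesis using c d False by (intro exI[of _ c] exI[of _ d]) auto
qed

section \<open>Integer matrices acting on the plane\<close>

definition int_mat2 :: "int \<Rightarrow> int \<Rightarrow> int \<Rightarrow> int \<Rightarrow> real^2^2" where
  "int_mat2 a b c d = vector [vector [of_int a, of_int b], vector [of_int c, of_int d]]"

lemma int_mat2_in_SL2Z: "a * d - b * c = 1 \<Longrightarrow> int_mat2 a b c d \<in> SL2Z"
  by (auto simp: SL2Z_def int_mat2_def det_2 forall_2 simp flip: of_int_mult of_int_diff)

lemma int_mat2_mult:
  "(int_mat2 a b c d *v x) $ 1 = a * x $ 1 + b * x $ 2"
  "(int_mat2 a b c d *v x) $ 2 = c * x $ 1 + d * x $ 2"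
  by (simp_all add: int_mat2_def matrix_vector_mult_def sum_2)

lemma infnorm_int_mat2: "infnorm (int_mat2 a b c d) = of_int (Max {\<bar>a\<bar>, \<bar>b\<bar>, \<bar>c\<bar>, \<bar>d\<bar>})"
  by (simp add: infnorm_mat2 int_mat2_def of_int_max)

lemma infnorm_int_mat2_le:
  fixes B :: real
  assumes "\<bar>a\<bar> \<le> B" "\<bar>b\<bar> \<le> B" "\<bar>c\<bar> \<le> B" "\<bar>d\<bar> \<le> B"
  shows "infnorm (int_mat2 a b c d) \<le> B"
  using assms by (simp add: infnorm_mat2 int_mat2_def)

lemma infnorm_SL2Z_pos: "\<gamma> \<in> SL2Z \<Longrightarrow> 0 < infnorm \<gamma>"
  by (auto simp: infnorm_pos_lt SL2Z_def det_2)

text \<open>A finite \<open>S\<close> would leave a least positive distance from \<open>y\<close>.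
  Exact hits are excluded because a single one would satisfy every bound \<eta>.\<close>

lemma infinite_approximants:
  fixes x y :: "real^2"
  assumes "\<And>\<eta>. \<eta> > 0 \<Longrightarrow> \<exists>\<gamma>\<in>S. \<gamma> *v x \<noteq> y \<and> infnorm (\<gamma> *v x - y) < \<eta>"
  shows "infinite S"
proof
  assume fin: "finite S"
  define D where "D = (\<lambda>\<gamma>. infnorm (\<gamma> *v x - y)) ` {\<gamma> \<in> S. \<gamma> *v x \<noteq> y}"
  \<comment> \<open>The element 1 makes the minimum meaningful even when \<open>D\<close> is
    empty.\<close>
  have "finite (insert 1 D)" using fin by (simp add: D_def)
  moreover have "\<forall>t\<in>insert 1 D. 0 < t" by (auto simp: D_def infnorm_pos_lt)
  ultimately have "0 < Min (insert 1 D)" by simp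
  then obtain \<gamma> where "\<gamma> \<in> S" "\<gamma> *v x \<noteq> y" "infnorm (\<gamma> *v x - y) < Min (insert 1 D)"
    using assms by blast
  moreover have "infnorm (\<gamma> *v x - y) \<ge> Min (insert 1 D)" if "\<gamma> \<in> S" "\<gamma> *v x \<noteq> y"
    using that fin by (intro Min_le) (auto simp: D_def)
  ultimately show False by simp
qed

text \<open>Let \<open>N\<close> have columns \<open>(a, b)\<close> and \<open>(c, d)\<close>. Then
  \<open>\<gamma> *v x\<close> is \<open>N\<close> applied to
  \<open>(\<rho> + l * \<epsilon>, \<epsilon>)\<close>. If \<open>\<rho> + l * \<epsilon>\<close> is
  within \<open>e\<close> of \<mu>, that vector differs from \<open>(\<mu>, 0)\<close> by at most
  \<open>e\<close> in each coordinate, and \<open>N\<close> turns this into at most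
  \<open>2 * H * e\<close>.\<close>

lemma orbit_point_near_multiple:
  fixes x y :: "real^2" and u v u' v' a b :: int and \<mu> :: real
  defines "e \<equiv> \<bar>u * x $ 1 + v * x $ 2\<bar>" and "q \<equiv> max \<bar>u\<bar> \<bar>v\<bar>" and "q' \<equiv> max \<bar>u'\<bar> \<bar>v'\<bar>"
    and "H \<equiv> max \<bar>a\<bar> \<bar>b\<bar>"
  assumes det: "\<bar>u' * v - u * v'\<bar> = 1" and e: "0 < e" "\<bar>u' * x $ 1 + v' * x $ 2\<bar> \<le> e"
    and "q \<le> q'" and ab: "coprime a b"
  shows "\<exists>\<gamma>\<in>SL2Z. \<gamma> *v x \<noteq> y \<and> \<bar>(\<gamma> *v x) $ 1 - \<mu> * a\<bar> \<le> 2 * real_of_int H * e \<and>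
    \<bar>(\<gamma> *v x) $ 2 - \<mu> * b\<bar> \<le> 2 * real_of_int H * e \<and> infnorm \<gamma> \<le> H * (4 * real_of_int q' + q * \<bar>\<mu>\<bar> / e)"
proof -
  obtain c d where cd: "a * d - b * c = 1" "\<bar>c\<bar> \<le> H" "\<bar>d\<bar> \<le> H"
    using coprime_completion[OF ab] unfolding H_def by blast
  \<comment> \<open>Multiplying the row \<open>(u', v')\<close> by the sign \<sigma> makes its
    determinant with \<open>(u, v)\<close> equal to +1.\<close>
  define \<sigma> where "\<sigma> = u' * v - u * v'"
  define r1 r2 where "r1 = \<sigma> * u'" and "r2 = \<sigma> * v'"
  have \<sigma>: "\<bar>\<sigma>\<bar> = 1" "\<sigma> * \<sigma> = 1" using det unfolding \<sigma>_def[symmetric] by (auto simp: abs_if split: if_splits)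
  have rdet: "r1 * v - r2 * u = 1"
  proof -
    have "r1 * v - r2 * u = \<sigma> * \<sigma>" by (simp add: r1_def r2_def \<sigma>_def algebra_simps)
    then show ?thesis using \<sigma> by simp
  qed
  have r: "\<bar>r1\<bar> \<le> q'" "\<bar>r2\<bar> \<le> q'" using \<sigma> by (auto simp: r1_def r2_def abs_mult q'_def)
  have uv: "\<bar>u\<bar> \<le> q" "\<bar>v\<bar> \<le> q" by (auto simp: q_def)
  have H: "0 \<le> H" "\<bar>a\<bar> \<le> H" "\<bar>b\<bar> \<le> H" "0 \<le> q" by (auto simp: H_def q_def)
  define \<epsilon> where "\<epsilon> = u * x $ 1 + v * x $ 2"
  define \<rho> where "\<rho> = r1 * x $ 1 + r2 * x $ 2"
  have "\<rho> = \<sigma> * (u' * x $ 1 + v' * x $ 2)" by (simp add: \<rho>_def r1_def r2_def algebra_simps)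
  moreover have "\<bar>real_of_int \<sigma>\<bar> = 1" using \<sigma> by linarith
  ultimately have \<rho>: "\<bar>\<rho>\<bar> \<le> e" using e by (simp add: abs_mult)
  have \<epsilon>: "\<bar>\<epsilon>\<bar> = e" "\<epsilon> \<noteq> 0" using e by (auto simp: e_def \<epsilon>_def)
  \<comment> \<open>The real solution of \<open>\<rho> + t * \<epsilon> = \<mu>\<close>, to be
    rounded to an integer \<open>l\<close>.\<close>
  define t where "t = (\<mu> - \<rho>) / \<epsilon>"
  have t: "\<bar>t\<bar> \<le> \<bar>\<mu>\<bar> / e + 1"
  proof -
    have "\<bar>t\<bar> = \<bar>\<mu> - \<rho>\<bar> / e" by (simp add: t_def \<epsilon>(1))
    also have "\<dots> \<le> (\<bar>\<mu>\<bar> + e) / e" using \<rho> e by (intro divide_right_mono) auto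
    also have "\<dots> = \<bar>\<mu>\<bar> / e + 1" using e by (simp add: field_simps)
    finally show ?thesis .
  qed
  \<comment> \<open>\<open>N\<close> times the matrix with rows \<open>(r1, r2) + l (u, v)\<close>
    and \<open>(u, v)\<close>.\<close>
  define g where "g l = int_mat2 (a * (r1 + l * u) + c * u) (a * (r2 + l * v) + c * v)
      (b * (r1 + l * u) + d * u) (b * (r2 + l * v) + d * v)" for l
  have gx: "(g l *v x) $ 1 = a * (\<rho> + l * \<epsilon>) + c * \<epsilon>" "(g l *v x) $ 2 = b * (\<rho> + l * \<epsilon>) + d * \<epsilon>" for l
    by (simp_all add: g_def int_mat2_mult \<rho>_def \<epsilon>_def algebra_simps)
  have g: "g l \<in> SL2Z" for l
  proof -
    have "(a * (r1 + l * u) + c * u) * (b * (r2 + l * v) + d * v) -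
        (a * (r2 + l * v) + c * v) * (b * (r1 + l * u) + d * u) = (a * d - b * c) * (r1 * v - r2 * u)"
      by (simp add: algebra_simps)
    then show ?thesis unfolding g_def using cd rdet by (intro int_mat2_in_SL2Z) simp
  qed
  have close: "\<bar>m * (\<rho> + l * \<epsilon>) + m' * \<epsilon> - \<mu> * m\<bar> \<le> 2 * real_of_int H * e"
    if "\<bar>l - t\<bar> \<le> 1" "\<bar>m\<bar> \<le> H" "\<bar>m'\<bar> \<le> H" for l m m' :: int
  proof -
    have eq: "m * (\<rho> + l * \<epsilon>) + m' * \<epsilon> - \<mu> * m = m * ((l - t) * \<epsilon>) + m' * \<epsilon>"
      using \<epsilon>(2) by (simp add: t_def field_simps)
    have m: "\<bar>real_of_int m\<bar> \<le> H" "\<bar>real_of_int m'\<bar> \<le> H" using that(2,3) by (simp_all flip: of_int_abs)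
    have "\<bar>m * ((l - t) * \<epsilon>) + m' * \<epsilon>\<bar> \<le> \<bar>m\<bar> * (\<bar>l - t\<bar> * e) + \<bar>m'\<bar> * e"
      using abs_triangle_ineq[of "m * ((l - t) * \<epsilon>)" "m' * \<epsilon>"] by (simp add: abs_mult \<epsilon>(1))
    also have "\<dots> \<le> H * (1 * e) + H * e"
      using m that e H by (intro add_mono mult_mono) auto
    finally show ?thesis unfolding eq by linarith
  qed
  have size: "\<bar>real_of_int (m * (s + l * w) + m' * w)\<bar> \<le> H * (4 * real_of_int q' + q * \<bar>\<mu>\<bar> / e)"
    if "\<bar>l - t\<bar> \<le> 1" "\<bar>m\<bar> \<le> H" "\<bar>m'\<bar> \<le> H" "\<bar>s\<bar> \<le> q'" "\<bar>w\<bar> \<le> q" for l m m' s w :: int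
  proof -
    have l: "\<bar>real_of_int l\<bar> \<le> \<bar>\<mu>\<bar> / e + 2" using that(1) t by linarith
    have m: "\<bar>real_of_int m\<bar> \<le> H" "\<bar>real_of_int m'\<bar> \<le> H" "\<bar>real_of_int s\<bar> \<le> q'" "\<bar>real_of_int w\<bar> \<le> q"
      "real_of_int q \<le> q'" "0 \<le> real_of_int q" "0 \<le> real_of_int H"
      using that(2-5) \<open>q \<le> q'\<close> H(1,4) by (simp_all flip: of_int_abs)
    have "\<bar>real_of_int (m * (s + l * w) + m' * w)\<bar> \<le> \<bar>real_of_int m\<bar> * \<bar>s + l * w\<bar> + \<bar>real_of_int m'\<bar> * \<bar>real_of_int w\<bar>"
      using abs_triangle_ineq[of "m * (s + l * w)" "m' * w"] by (simp flip: abs_mult of_int_mult of_int_add)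
    also have "\<dots> \<le> H * (q' + (\<bar>\<mu>\<bar> / e + 2) * q) + H * q"
    proof (intro add_mono mult_mono)
      have "real_of_int \<bar>s + l * w\<bar> \<le> \<bar>real_of_int s\<bar> + \<bar>real_of_int l\<bar> * \<bar>real_of_int w\<bar>"
        using abs_triangle_ineq[of s "l * w"] by (simp flip: abs_mult of_int_mult of_int_add)
      also have "\<dots> \<le> q' + (\<bar>\<mu>\<bar> / e + 2) * q"
        using m l e by (intro add_mono mult_mono) auto
      finally show "real_of_int \<bar>s + l * w\<bar> \<le> q' + (\<bar>\<mu>\<bar> / e + 2) * q" .
    qed (use m in \<open>auto intro: mult_mono\<close>)
    \<comment> \<open>Two of the three \<open>q\<close> come from the bound on \<open>l\<close>, the
      third from the completing column; \<open>q \<le> q'\<close> then gives the constant 4.\<close>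
    also have "\<dots> = H * (q' + 3 * q + q * \<bar>\<mu>\<bar> / e)" by (simp add: algebra_simps)
    also have "\<dots> \<le> H * (4 * real_of_int q' + q * \<bar>\<mu>\<bar> / e)" using m by (intro mult_left_mono) auto
    finally show ?thesis by simp
  qed
  have norm: "infnorm (g l) \<le> H * (4 * real_of_int q' + q * \<bar>\<mu>\<bar> / e)" if "\<bar>l - t\<bar> \<le> 1" for l
    unfolding g_def by (intro infnorm_int_mat2_le size that H cd r uv)
  \<comment> \<open>Either rounding of \<open>t\<close> will do, so one of them avoids \<open>y\<close>.\<close>
  have "g \<lfloor>t\<rfloor> *v x \<noteq> g (\<lfloor>t\<rfloor> + 1) *v x"
  proof
    assume "g \<lfloor>t\<rfloor> *v x = g (\<lfloor>t\<rfloor> + 1) *v x"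
    then have "a * \<epsilon> = 0" "b * \<epsilon> = 0"
      using gx[of "\<lfloor>t\<rfloor>"] gx[of "\<lfloor>t\<rfloor> + 1"] by (auto simp: algebra_simps)
    then show False using \<epsilon> ab by auto
  qed
  moreover have "\<bar>\<lfloor>t\<rfloor> - t\<bar> \<le> 1" "\<bar>(\<lfloor>t\<rfloor> + 1) - t\<bar> \<le> 1" by linarith+
  ultimately obtain l where l: "g l *v x \<noteq> y" "\<bar>real_of_int l - t\<bar> \<le> 1" by (metis of_int_add of_int_1)
  then show ?thesis
    using g[of l] norm[of l] close[OF l(2) H(2) cd(2)] close[OF l(2) H(3) cd(3)]
    by (intro bexI[of _ "g l"]) (auto simp: gx)
qed

section \<open>Norm estimates\<close>

text \<open>Keeps the main estimate free of roots: for nonnegative numbers the claim may be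
  squared.\<close>

lemma le_of_square_mult_le:
  fixes E G C X Y :: real
  assumes "E ^ 2 * G \<le> C ^ 2 * X * Y" "0 < G" "0 \<le> C" "0 \<le> X" "0 \<le> Y"
  shows "E \<le> (C * X powr (1/2) * Y powr (1/2)) / G powr (1/2)"
proof (rule power2_le_imp_le)
  have "E\<^sup>2 \<le> C ^ 2 * X * Y / G" using assms by (simp add: field_simps)
  also have "\<dots> = ((C * X powr (1/2) * Y powr (1/2)) / G powr (1/2))\<^sup>2"
    using assms by (simp add: power_divide power_mult_distrib powr_half_sqrt)
  finally show "E\<^sup>2 \<le> ((C * X powr (1/2) * Y powr (1/2)) / G powr (1/2))\<^sup>2" .
qed (use assms in simp)

lemma le_of_cube_mult_le:
  fixes E G C X Y :: real
  assumes "E ^ 3 * G \<le> C ^ 3 * X * Y ^ 2" "0 < G" "0 \<le> C" "0 \<le> X" "0 \<le> Y"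
  shows "E \<le> (C * X powr (1/3) * Y powr (2/3)) / G powr (1/3)"
proof (rule power_le_imp_le_base)
  have p: "(z powr (1/3)) ^ 3 = z" "(z powr (2/3)) ^ 3 = z ^ 2" if "0 \<le> z" for z :: real
    using that by (cases "z = 0"; simp add: powr_power powr_numeral)+
  have "E ^ 3 \<le> C ^ 3 * X * Y ^ 2 / G" using assms by (simp add: field_simps)
  also have "\<dots> = ((C * X powr (1/3) * Y powr (2/3)) / G powr (1/3)) ^ 3"
    using assms by (simp add: power_divide power_mult_distrib p)
  finally show "E ^ Suc 2 \<le> ((C * X powr (1/3) * Y powr (2/3)) / G powr (1/3)) ^ Suc 2"
    by (simp add: numeral_3_eq_3)
qed (use assms in simp)

text \<open>\<open>E\<close> stands for the distance of \<open>\<gamma> *v x\<close> from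
  \<open>y\<close>, \<open>G\<close> for the norm of \<gamma>, and \<open>X\<close>,
  \<open>Y\<close> for the norms of \<open>x\<close>, \<open>y\<close>. The product expands into two
  terms: one is controlled by \<open>2 * H * e \<le> Y\<close> and \<open>q' * e \<le> X\<close>,
  the other by \<open>q * e \<le> X\<close> and \<open>H * m = Y\<close>. They contribute 8 + 4 =
  12.\<close>

lemma rational_target_estimate:
  fixes E G H X Y e q q' m :: real
  assumes "0 \<le> E" "E \<le> 2 * H * e" "0 \<le> G" "G \<le> H * (4 * q' + q * m / e)" "q' * e \<le> X"
    "0 \<le> q" "q \<le> q'" "H * m = Y" "2 * H * e \<le> Y" "0 < e" "0 < H"
  shows "E ^ 2 * G \<le> 12 * H ^ 2 * X * Y"
proof -
  have Y: "0 \<le> Y" using assms by (smt (verit) mult_pos_pos)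
  have "0 \<le> q' * e" "0 \<le> X" using assms by (smt (verit) mult_nonneg_nonneg)+
  have "E ^ 2 * G \<le> (2 * H * e) ^ 2 * (H * (4 * q' + q * m / e))"
    using assms by (intro mult_mono power_mono) auto
  also have "\<dots> = 8 * H ^ 2 * (2 * H * e) * (q' * e) + 4 * H ^ 2 * (q * e) * (H * m)"
    using \<open>0 < e\<close> by (simp add: field_simps power2_eq_square)
  also have "\<dots> \<le> 8 * H ^ 2 * Y * X + 4 * H ^ 2 * X * Y"
  proof (intro add_mono mult_mono)
    show "q * e \<le> X" using assms by (smt (verit) mult_right_mono)
  qed (use assms Y \<open>0 \<le> q' * e\<close> \<open>0 \<le> X\<close> in auto)
  finally show ?thesis by (simp add: mult_ac)
qed

text \<open>The distance is at most \<open>2 * A + B\<close>, where \<open>A\<close> comes from the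
  orbit point and \<open>B\<close> from replacing \<open>y\<close> by a multiple of an integer
  vector; \<open>G\<close> is at most \<open>4 * (Q * q') + q * Y / e\<close>. Multiplying out
  leaves four products, each compared with \<open>X * Y ^ 2\<close> through the interlacing
  conditions \<open>c\<close>; the total is 128 + 32 + 16 + 8 = 184.\<close>

lemma irrational_target_estimate:
  fixes E G Q R X Y e q q' m :: real
  assumes "0 \<le> E" "E \<le> 2 * Q * e + Y / (Q * R)" "0 \<le> G" "G \<le> Q * (4 * q' + q * m / e)"
    "q' * e \<le> X" "X \<le> 2 * (q' * e)" "0 \<le> q" "q \<le> q'" "Q * m \<le> Y" "0 < e" "1 \<le> Q" "1 \<le> R"
    and c: "Y * q \<le> X * Q ^ 3" "X * Q ^ 3 \<le> Y * q'" "Y * q' \<le> X * R ^ 3" and "0 < X" "0 < Y"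
  shows "E ^ 3 * G \<le> 184 * X * Y ^ 2"
proof -
  have q': "0 < q'" using assms by (smt (verit) mult_nonneg_nonneg mult_le_0_iff)
  have cube: "(r + s) ^ 3 \<le> 4 * (r ^ 3 + s ^ 3)" if "0 \<le> r" "0 \<le> s" for r s :: real
  proof -
    have "4 * (r ^ 3 + s ^ 3) - (r + s) ^ 3 = 3 * ((r + s) * (r - s) ^ 2)"
      by (simp add: power2_eq_square power3_eq_cube algebra_simps)
    moreover have "0 \<le> (r + s) * (r - s) ^ 2" using that by simp
    ultimately show ?thesis by linarith
  qed
  define A B where "A = Q * e" and "B = Y / (Q * R)"
  have AB: "0 \<le> A" "0 \<le> B" using assms by (auto simp: A_def B_def)
  \<comment> \<open>The middle interlacing inequality, multiplied by \<open>e\<close> and combined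
    with \<open>q' * e \<le> X\<close>.\<close>
  have Qe: "Q ^ 3 * e \<le> Y"
  proof -
    have "X * Q ^ 3 * e \<le> Y * q' * e" using c(2) assms by (intro mult_right_mono) auto
    also have "\<dots> \<le> Y * X" using assms by (simp add: mult.assoc)
    finally show ?thesis using \<open>0 < X\<close> by (simp add: mult_ac)
  qed
  have qe: "q * e \<le> X" using assms by (smt (verit) mult_right_mono)
  have T1: "A ^ 3 * (Q * q') \<le> X * Y ^ 2"
  proof -
    have "A ^ 3 * (Q * q') = Q ^ 4 * e ^ 2 * (q' * e)"
      by (simp add: A_def power_mult_distrib power2_eq_square power3_eq_cube power4_eq_xxxx)
    also have "\<dots> \<le> Q ^ 6 * e ^ 2 * X"
      using assms q' by (intro mult_mono) (auto intro!: power_increasing)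
    also have "\<dots> = (Q ^ 3 * e) ^ 2 * X" by (simp add: power_mult_distrib flip: power_mult)
    also have "\<dots> \<le> Y ^ 2 * X" using Qe assms by (intro mult_right_mono power_mono) auto
    finally show ?thesis by (simp add: mult.commute)
  qed
  have T2: "A ^ 3 * (q * Y / e) \<le> X * Y ^ 2"
  proof -
    have "A ^ 3 * (q * Y / e) = (Q ^ 3 * e) * (q * e) * Y"
      using \<open>0 < e\<close> by (simp add: A_def power_mult_distrib power3_eq_cube)
    also have "\<dots> \<le> Y * X * Y"
      using Qe qe assms by (intro mult_mono) auto
    finally show ?thesis by (simp add: power2_eq_square mult_ac)
  qed
  have YR: "Y * q' / R ^ 3 \<le> X" "Y * q / Q ^ 3 \<le> X"
    using c assms by (simp_all add: field_simps)
  have T3: "B ^ 3 * (Q * q') \<le> X * Y ^ 2"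
  proof -
    have "B ^ 3 * (Q * q') = Y ^ 2 * (Y * q' / R ^ 3) / Q ^ 2"
      using assms by (simp add: B_def field_simps power2_eq_square power3_eq_cube)
    also have "\<dots> \<le> Y ^ 2 * X / 1"
      using YR assms q' by (intro frac_le mult_left_mono) (auto simp: one_le_power)
    finally show ?thesis by (simp add: mult.commute)
  qed
  \<comment> \<open>Dividing by \<open>e\<close> calls for a lower bound on it:
    \<open>X \<le> 2 * (q' * e)\<close> enters here and causes the factor 2.\<close>
  have T4: "B ^ 3 * (q * Y / e) \<le> 2 * (X * Y ^ 2)"
  proof -
    have "Y / R ^ 3 \<le> X / q'" using YR(1) q' by (simp add: field_simps)
    also have "\<dots> \<le> 2 * e" using assms q' by (simp add: field_simps)
    finally have *: "Y / R ^ 3 / e \<le> 2" using \<open>0 < e\<close> by (subst pos_divide_le_eq) auto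
    have "B ^ 3 * (q * Y / e) = Y ^ 2 * ((Y * q / Q ^ 3) * (Y / R ^ 3 / e))"
      using assms by (simp add: B_def field_simps power2_eq_square power3_eq_cube)
    also have "\<dots> \<le> Y ^ 2 * (X * 2)"
      using YR * assms by (intro mult_left_mono mult_mono) auto
    finally show ?thesis by (simp add: mult_ac)
  qed
  have "Q * (4 * q' + q * m / e) = 4 * (Q * q') + q * (Q * m) / e" by (simp add: algebra_simps)
  also have "\<dots> \<le> 4 * (Q * q') + q * Y / e"
    using assms by (intro add_left_mono divide_right_mono mult_left_mono) auto
  finally have G: "G \<le> 4 * (Q * q') + q * Y / e" using assms by linarith
  have "E ^ 3 \<le> (2 * A + B) ^ 3" using assms by (intro power_mono) (auto simp: A_def B_def)
  also have "\<dots> \<le> 4 * ((2 * A) ^ 3 + B ^ 3)" using AB by (intro cube) auto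
  finally have "E ^ 3 \<le> 32 * A ^ 3 + 4 * B ^ 3" by (simp add: power_mult_distrib)
  then have "E ^ 3 * G \<le> (32 * A ^ 3 + 4 * B ^ 3) * (4 * (Q * q') + q * Y / e)"
    using G assms AB by (intro mult_mono) auto
  also have "\<dots> = 128 * (A ^ 3 * (Q * q')) + 32 * (A ^ 3 * (q * Y / e)) + 16 * (B ^ 3 * (Q * q'))
      + 4 * (B ^ 3 * (q * Y / e))"
    by (simp add: algebra_simps)
  also have "\<dots> \<le> 184 * (X * Y ^ 2)" using T1 T2 T3 T4 by linarith
  finally show ?thesis by (simp add: mult.assoc)
qed

section \<open>Approximation by orbit points\<close>

text \<open>With rows \<open>s\<^sub>k\<^sub>+\<^sub>1\<close> (up to sign) and
  \<open>s\<^sub>k\<close>, the image of \<open>x\<close> has norm \<open>e\<^sub>k\<close> and the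
  matrix has norm \<open>q\<^sub>k\<^sub>+\<^sub>1\<close>. Since \<open>e\<^sub>k\<close> is
  positive and becomes arbitrarily small, infinitely many matrices arise.\<close>

lemma infinite_contracting:
  assumes "irrational_slope x"
  shows "infinite {\<gamma> \<in> SL2Z. infnorm (\<gamma> *v x) \<le> infnorm x / infnorm \<gamma>}"
proof -
  obtain u v where uv: "approx_seq (x $ 1) (x $ 2) u v"
    using approx_seq_exists assms unfolding irrational_slope_def slope_def by blast
  show ?thesis
  proof (rule infinite_approximants[of _ x 0])
    fix \<eta> :: real assume "\<eta> > 0"
    then obtain k where k: "\<bar>u k * x $ 1 + v k * x $ 2\<bar> < \<eta>" using approx_seq_small[OF uv] by blast
    note D = approx_seqD[OF uv, of k]
    define \<sigma> where "\<sigma> = u (Suc k) * v k - u k * v (Suc k)"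
    have \<sigma>: "\<sigma> = 1 \<or> \<sigma> = -1" using D(1) unfolding \<sigma>_def by linarith
    define \<gamma> where "\<gamma> = int_mat2 (\<sigma> * u (Suc k)) (\<sigma> * v (Suc k)) (u k) (v k)"
    have "\<sigma> * u (Suc k) * v k - \<sigma> * v (Suc k) * u k = \<sigma> * \<sigma>" by (simp add: \<sigma>_def algebra_simps)
    then have \<gamma>: "\<gamma> \<in> SL2Z" unfolding \<gamma>_def using \<sigma> by (intro int_mat2_in_SL2Z) auto
    define e where "e = \<bar>u k * x $ 1 + v k * x $ 2\<bar>"
    have "(\<gamma> *v x) $ 1 = \<sigma> * (u (Suc k) * x $ 1 + v (Suc k) * x $ 2)"
      by (simp add: \<gamma>_def int_mat2_mult algebra_simps)
    then have "\<bar>(\<gamma> *v x) $ 1\<bar> = \<bar>u (Suc k) * x $ 1 + v (Suc k) * x $ 2\<bar>"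
      using \<sigma> by auto
    moreover have "\<bar>(\<gamma> *v x) $ 2\<bar> = e"
      by (simp add: \<gamma>_def int_mat2_mult e_def)
    ultimately have norm: "infnorm (\<gamma> *v x) = e"
      using D(6) by (simp add: infnorm_vec2 e_def)
    have "Max {\<bar>\<sigma> * u (Suc k)\<bar>, \<bar>\<sigma> * v (Suc k)\<bar>, \<bar>u k\<bar>, \<bar>v k\<bar>} = max \<bar>u (Suc k)\<bar> \<bar>v (Suc k)\<bar>"
    proof -
      have "\<bar>\<sigma> * u (Suc k)\<bar> = \<bar>u (Suc k)\<bar>" "\<bar>\<sigma> * v (Suc k)\<bar> = \<bar>v (Suc k)\<bar>"
        using D(1) by (simp_all add: abs_mult \<sigma>_def)
      then show ?thesis using D(4) by (simp add: max.absorb1 flip: max.assoc)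
    qed
    then have "infnorm \<gamma> = max \<bar>u (Suc k)\<bar> \<bar>v (Suc k)\<bar>"
      by (simp only: \<gamma>_def infnorm_int_mat2)
    then have "e \<le> infnorm x / infnorm \<gamma>"
      using D(7) infnorm_SL2Z_pos[OF \<gamma>] by (simp add: infnorm_vec2 e_def field_simps)
    moreover have "\<gamma> *v x \<noteq> 0" using norm D(5) by (auto simp: e_def infnorm_0)
    ultimately show "\<exists>\<gamma>\<in>{\<gamma> \<in> SL2Z. infnorm (\<gamma> *v x) \<le> infnorm x / infnorm \<gamma>}.
        \<gamma> *v x \<noteq> 0 \<and> infnorm (\<gamma> *v x - 0) < \<eta>"
      using \<gamma> norm k by (intro bexI[of _ \<gamma>]) (auto simp: e_def)
  qed
qed

text \<open>Triangle inequality through \<open>\<mu> (a, b)\<close>: the first error is that of the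
  orbit point, the second that of the multiple as a substitute for \<open>y\<close>.\<close>

lemma approx_orbit_point:
  fixes x y :: "real^2" and a b :: int and \<mu> :: real and k :: nat
  assumes uv: "approx_seq (x $ 1) (x $ 2) u v" and "coprime a b"
  defines "e \<equiv> \<bar>u k * x $ 1 + v k * x $ 2\<bar>" and "q \<equiv> \<lambda>k. max \<bar>u k\<bar> \<bar>v k\<bar>"
    and "H \<equiv> max \<bar>a\<bar> \<bar>b\<bar>"
  shows "\<exists>\<gamma>\<in>SL2Z. \<gamma> *v x \<noteq> y \<and> infnorm (\<gamma> *v x - y) \<le> 2 * real_of_int H * e + max \<bar>y $ 1 - \<mu> * a\<bar> \<bar>y $ 2 - \<mu> * b\<bar>
    \<and> infnorm \<gamma> \<le> H * (4 * real_of_int (q (Suc k)) + q k * \<bar>\<mu>\<bar> / e)"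
proof -
  note D = approx_seqD[OF uv, of k]
  obtain \<gamma> where \<gamma>: "\<gamma> \<in> SL2Z" "\<gamma> *v x \<noteq> y" "\<bar>(\<gamma> *v x) $ 1 - \<mu> * a\<bar> \<le> 2 * real_of_int H * e"
    "\<bar>(\<gamma> *v x) $ 2 - \<mu> * b\<bar> \<le> 2 * real_of_int H * e" "infnorm \<gamma> \<le> H * (4 * real_of_int (q (Suc k)) + q k * \<bar>\<mu>\<bar> / e)"
    using orbit_point_near_multiple[OF D(1) D(5) less_imp_le[OF D(6)] D(4) assms(2), of y \<mu>]
    unfolding e_def q_def H_def by blast
  have "infnorm (\<gamma> *v x - y) \<le> 2 * real_of_int H * e + max \<bar>y $ 1 - \<mu> * a\<bar> \<bar>y $ 2 - \<mu> * b\<bar>"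
    using \<gamma>(3,4) unfolding infnorm_vec2 vector_minus_component by linarith
  then show ?thesis using \<gamma> by blast
qed

section \<open>Targets of rational slope\<close>

text \<open>The fraction \<open>a / b\<close> may not be in lowest terms; dividing by the gcd gives
  a primitive direction without increasing the maximum.\<close>

lemma rational_slope_multiple:
  fixes y :: "real^2" and a b :: int
  assumes "(y $ 2 \<noteq> 0 \<and> b \<noteq> 0 \<and> slope y = of_int a / of_int b) \<or> (y $ 2 = 0 \<and> a = 1 \<and> b = 0)"
  shows "\<exists>a' b' \<mu>. coprime a' b' \<and> max \<bar>a'\<bar> \<bar>b'\<bar> \<le> max \<bar>a\<bar> \<bar>b\<bar> \<and>
    y $ 1 = \<mu> * real_of_int a' \<and> y $ 2 = \<mu> * real_of_int b'"
proof -
  define g where "g = gcd a b"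
  have ab: "a \<noteq> 0 \<or> b \<noteq> 0" using assms by auto
  then have g: "1 \<le> g" by (simp add: g_def int_one_le_iff_zero_less)
  obtain a' b' where a': "a = a' * g" "b = b' * g" "coprime a' b'"
    using gcd_coprime_exists[of a b] ab unfolding g_def by auto
  have le: "\<bar>a'\<bar> \<le> \<bar>a\<bar>" "\<bar>b'\<bar> \<le> \<bar>b\<bar>" using g unfolding a' abs_mult
    by (simp_all add: mult_le_cancel_left1)
  show ?thesis
  proof (cases "b = 0")
    case True
    then have "y $ 2 = 0" "a = 1" using assms by auto
    then show ?thesis using True by (intro exI[of _ 1] exI[of _ 0] exI[of _ "y $ 1"]) simp
  next
    case False
    then have "y $ 2 \<noteq> 0" "y $ 1 / y $ 2 = a / b" using assms by (auto simp: slope_def)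
    then have "y $ 1 = y $ 2 / b' * a'" using False g
      by (simp add: a' field_simps)
    moreover have "b' \<noteq> 0" using False a' by auto
    ultimately show ?thesis using a' le
      by (intro exI[of _ a'] exI[of _ b'] exI[of _ "y $ 2 / b'"]) auto
  qed
qed

lemma infinite_approximants_rational:
  fixes x y :: "real^2" and a b :: int
  assumes "irrational_slope x" "y \<noteq> 0"
    and slope: "(y $ 2 \<noteq> 0 \<and> b \<noteq> 0 \<and> slope y = of_int a / of_int b) \<or> (y $ 2 = 0 \<and> a = 1 \<and> b = 0)"
  shows "infinite {\<gamma> \<in> SL2Z. infnorm (\<gamma> *v x - y)
            \<le> (2 * sqrt 3 * of_int (max \<bar>a\<bar> \<bar>b\<bar>) * infnorm x powr (1/2) * infnorm y powr (1/2))
               / infnorm \<gamma> powr (1/2)}"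
proof -
  obtain u v where uv: "approx_seq (x $ 1) (x $ 2) u v"
    using approx_seq_exists assms unfolding irrational_slope_def slope_def by blast
  obtain a' b' \<mu> where cop: "coprime a' b'" and le: "max \<bar>a'\<bar> \<bar>b'\<bar> \<le> max \<bar>a\<bar> \<bar>b\<bar>"
      and y: "y $ 1 = \<mu> * real_of_int a'" "y $ 2 = \<mu> * real_of_int b'"
    using rational_slope_multiple[OF slope] by blast
  define H where "H = max \<bar>a'\<bar> \<bar>b'\<bar>"
  have H: "1 \<le> H" using cop by (auto simp: H_def le_max_iff_disj int_one_le_iff_zero_less)
  have Y: "H * \<bar>\<mu>\<bar> = infnorm y"
    by (simp add: infnorm_vec2 y H_def abs_mult max_mult_distrib_left of_int_max mult.commute)
  have Ypos: "0 < infnorm y" using assms(2) by (simp add: infnorm_pos_lt)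
  show ?thesis
  proof (rule infinite_approximants[of _ x y])
    fix \<eta> :: real assume "\<eta> > 0"
    \<comment> \<open>Making \<open>2 * H * e\<close> smaller than \<eta> gives closeness; making it
      smaller than the norm of \<open>y\<close> is what the norm estimate asks for.\<close>
    then have "0 < min \<eta> (infnorm y) / (2 * H)" using Ypos H by simp
    then obtain k where k: "\<bar>u k * x $ 1 + v k * x $ 2\<bar> < min \<eta> (infnorm y) / (2 * H)"
      using approx_seq_small[OF uv] by blast
    note D = approx_seqD[OF uv, of k]
    define e q q' where "e = \<bar>u k * x $ 1 + v k * x $ 2\<bar>" and "q = max \<bar>u k\<bar> \<bar>v k\<bar>"
      and "q' = max \<bar>u (Suc k)\<bar> \<bar>v (Suc k)\<bar>"
    have He: "2 * real_of_int H * e < min \<eta> (infnorm y)" using k H by (simp add: e_def field_simps)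
    obtain \<gamma> where \<gamma>: "\<gamma> \<in> SL2Z" "\<gamma> *v x \<noteq> y" "infnorm (\<gamma> *v x - y) \<le> 2 * real_of_int H * e"
        "infnorm \<gamma> \<le> H * (4 * real_of_int q' + q * \<bar>\<mu>\<bar> / e)"
      using approx_orbit_point[OF uv cop, where y = y and \<mu> = \<mu> and k = k]
      unfolding y e_def q_def q'_def H_def by auto
    have *: "0 < e" "q' * e \<le> infnorm x" "1 \<le> q" "q \<le> q'"
      using D(3,4,5,7) by (simp_all only: e_def q_def q'_def infnorm_vec2)
    have "infnorm (\<gamma> *v x - y) ^ 2 * infnorm \<gamma> \<le> 12 * real_of_int H ^ 2 * infnorm x * infnorm y"
      by (rule rational_target_estimate[OF infnorm_pos_le \<gamma>(3) infnorm_pos_le \<gamma>(4) _ _ _ Y])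
        (use * H He in auto)
    also have "\<dots> \<le> (2 * sqrt 3 * of_int (max \<bar>a\<bar> \<bar>b\<bar>)) ^ 2 * infnorm x * infnorm y"
    proof -
      have "real_of_int H ^ 2 \<le> of_int (max \<bar>a\<bar> \<bar>b\<bar>) ^ 2"
        using le[folded H_def] H by (intro power_mono) (simp_all del: of_int_max)
      then show ?thesis
        by (intro mult_right_mono infnorm_pos_le) (simp add: power_mult_distrib)
    qed
    finally have "infnorm (\<gamma> *v x - y)
        \<le> (2 * sqrt 3 * of_int (max \<bar>a\<bar> \<bar>b\<bar>) * infnorm x powr (1/2) * infnorm y powr (1/2))
               / infnorm \<gamma> powr (1/2)"
      by (rule le_of_square_mult_le) (use infnorm_SL2Z_pos[OF \<gamma>(1)] infnorm_pos_le in auto)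
    then show "\<exists>\<gamma>\<in>{\<gamma> \<in> SL2Z. infnorm (\<gamma> *v x - y)
            \<le> (2 * sqrt 3 * of_int (max \<bar>a\<bar> \<bar>b\<bar>) * infnorm x powr (1/2) * infnorm y powr (1/2))
               / infnorm \<gamma> powr (1/2)}. \<gamma> *v x \<noteq> y \<and> infnorm (\<gamma> *v x - y) < \<eta>"
      using \<gamma> He by (intro bexI[of _ \<gamma>]) auto
  qed
qed

section \<open>Targets of irrational slope\<close>

text \<open>Choose \<mu> so that the coordinate in which \<open>(a, b)\<close> is larger is matched
  exactly; the error in the other one is the determinant divided by \<open>H\<close>.\<close>

lemma close_multiple:
  fixes y1 y2 :: real and a b :: int
  defines "H \<equiv> max \<bar>a\<bar> \<bar>b\<bar>"
  assumes "0 < H"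
  shows "\<exists>\<mu>::real. H * \<bar>\<mu>\<bar> \<le> max \<bar>y1\<bar> \<bar>y2\<bar> \<and> max \<bar>y1 - \<mu> * a\<bar> \<bar>y2 - \<mu> * b\<bar> \<le> \<bar>a * y2 - b * y1\<bar> / H"
proof (cases "\<bar>a\<bar> \<le> \<bar>b\<bar>")
  case True
  then have H: "H = \<bar>b\<bar>" "b \<noteq> 0" using assms by auto
  then have "y1 - y2 / b * a = - (a * y2 - b * y1) / b" by (simp add: field_simps)
  then have "\<bar>y1 - y2 / b * a\<bar> = \<bar>a * y2 - b * y1\<bar> / H" using H by (simp add: abs_minus_commute)
  then show ?thesis using H by (intro exI[of _ "y2 / b"]) auto
next
  case False
  then have H: "H = \<bar>a\<bar>" "a \<noteq> 0" using assms by auto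
  then have "y2 - y1 / a * b = (a * y2 - b * y1) / a" by (simp add: field_simps)
  then have "\<bar>y2 - y1 / a * b\<bar> = \<bar>a * y2 - b * y1\<bar> / H" using H by simp
  then show ?thesis using H by (intro exI[of _ "y1 / a"]) auto
qed

lemma infinite_approximants_irrational:
  fixes x y :: "real^2"
  assumes "irrational_slope x" "irrational_slope y"
  shows "infinite {\<gamma> \<in> SL2Z. infnorm (\<gamma> *v x - y)
            \<le> (7 * sqrt 5 * infnorm x powr (1/3) * infnorm y powr (2/3)) / infnorm \<gamma> powr (1/3)}"
proof -
  obtain u v where uv: "approx_seq (x $ 1) (x $ 2) u v"
    using approx_seq_exists assms unfolding irrational_slope_def slope_def by blast
  obtain U V where UV: "approx_seq (y $ 1) (y $ 2) U V"
    using approx_seq_exists assms unfolding irrational_slope_def slope_def by blast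
  define X Y where "X = infnorm x" and "Y = infnorm y"
  have XY: "0 < X" "0 < Y"
    using assms by (auto simp: X_def Y_def irrational_slope_def infnorm_pos_lt)
  define q Q where "q k = max \<bar>u k\<bar> \<bar>v k\<bar>" and "Q k = max \<bar>U k\<bar> \<bar>V k\<bar>" for k
  have Q: "1 \<le> Q j" "int j \<le> Q j" "Q j \<le> Q (Suc j)" for j
    using approx_seqD(2-4)[OF UV, of j] by (simp_all only: Q_def)
  \<comment> \<open>Interlacing \<open>f\<close> with the sequence \<open>Y / X * q k\<close> is,
    after clearing \<open>X\<close>, the balance condition between the two errors.\<close>
  define f where "f j = real_of_int (Q j) ^ 3" for j
  have "mono f"
  proof (intro incseq_SucI)
    show "f j \<le> f (Suc j)" for j
      using Q[of j] unfolding f_def by (intro power_mono) auto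
  qed
  have f_lim: "filterlim f at_top sequentially"
  proof (rule filterlim_at_top_mono[OF approx_seq_filterlim[OF UV zero_less_one]])
    have "real_of_int (Q j) ^ 1 \<le> real_of_int (Q j) ^ 3" for j
      using Q(1)[of j] by (intro power_increasing) auto
    then show "\<forall>\<^sub>F j in sequentially. 1 * real_of_int (max \<bar>U j\<bar> \<bar>V j\<bar>) \<le> f j"
      unfolding Q_def[symmetric] by (simp add: f_def)
  qed
  have g_lim: "filterlim (\<lambda>k. Y / X * real_of_int (q k)) at_top sequentially"
    unfolding q_def by (intro approx_seq_filterlim[OF uv] divide_pos_pos XY)
  show ?thesis
  proof (rule infinite_approximants[of _ x y])
    fix \<eta> :: real assume "\<eta> > 0"
    \<comment> \<open>The final distance will be at most \<open>3 * Y / Q j\<close>.\<close>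
    obtain j0 :: nat where j0: "3 * Y / \<eta> < j0" using reals_Archimedean2 by blast
    obtain j k where jk: "j0 \<le> j" "Y / X * q k < f j" "f j \<le> Y / X * q (Suc k)"
        "Y / X * q (Suc k) < f (Suc j)"
      using exists_interlacing[OF \<open>mono f\<close> f_lim g_lim] by blast
    note D = approx_seqD[OF uv, of k] and D' = approx_seqD[OF UV, of j]
    have c: "Y * q k \<le> X * real_of_int (Q j) ^ 3" "X * real_of_int (Q j) ^ 3 \<le> Y * q (Suc k)" "Y * q (Suc k) \<le> X * real_of_int (Q (Suc j)) ^ 3"
      using jk XY by (simp_all add: f_def field_simps)
    define e where "e = \<bar>u k * x $ 1 + v k * x $ 2\<bar>"
    \<comment> \<open>The column orthogonal to the row \<open>(U j, V j)\<close>; its determinant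
      with \<open>y\<close> is therefore, up to sign, the small residual of that row.\<close>
    define a b where "a = - V j" and "b = U j"
    have QH: "Q j = max \<bar>a\<bar> \<bar>b\<bar>" by (simp add: Q_def a_def b_def max.commute)
    have cop: "coprime a b"
    proof (rule coprimeI)
      fix c assume "c dvd a" "c dvd b"
      then have "c dvd V j" "c dvd U j" by (simp_all add: a_def b_def)
      then have "c dvd U (Suc j) * V j - U j * V (Suc j)" by (intro dvd_diff dvd_mult dvd_mult2)
      then show "is_unit c" using D'(1) by (metis dvd_abs_iff)
    qed
    have "0 < max \<bar>a\<bar> \<bar>b\<bar>" using Q(1)[of j] unfolding QH by linarith
    from close_multiple[OF this, folded QH, of "y $ 1" "y $ 2"]
    obtain \<mu> :: real where \<mu>: "Q j * \<bar>\<mu>\<bar> \<le> Y"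
        "max \<bar>y $ 1 - \<mu> * a\<bar> \<bar>y $ 2 - \<mu> * b\<bar> \<le> \<bar>a * y $ 2 - b * y $ 1\<bar> / Q j"
      unfolding Y_def infnorm_vec2 by blast
    have "a * y $ 2 - b * y $ 1 = - (U j * y $ 1 + V j * y $ 2)" by (simp add: a_def b_def)
    then have "\<bar>a * y $ 2 - b * y $ 1\<bar> = \<bar>U j * y $ 1 + V j * y $ 2\<bar>" by (simp only: abs_minus_cancel)
    also have "Q (Suc j) * \<dots> \<le> Y"
      using D'(7) by (simp only: Y_def infnorm_vec2 Q_def)
    then have "\<bar>U j * y $ 1 + V j * y $ 2\<bar> \<le> Y / Q (Suc j)"
      using Q(1)[of "Suc j"] by (simp add: pos_le_divide_eq mult.commute)
    finally have "\<bar>a * y $ 2 - b * y $ 1\<bar> / Q j \<le> Y / Q (Suc j) / Q j"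
      using Q(1)[of j] by (intro divide_right_mono) auto
    then have err: "max \<bar>y $ 1 - \<mu> * a\<bar> \<bar>y $ 2 - \<mu> * b\<bar> \<le> Y / (real_of_int (Q j) * Q (Suc j))"
      using \<mu>(2) by (simp add: mult.commute)
    from approx_orbit_point[OF uv cop, where y = y and \<mu> = \<mu> and k = k, folded QH q_def e_def]
    obtain \<gamma> where \<gamma>: "\<gamma> \<in> SL2Z" "\<gamma> *v x \<noteq> y"
        "infnorm (\<gamma> *v x - y) \<le> 2 * real_of_int (Q j) * e + max \<bar>y $ 1 - \<mu> * a\<bar> \<bar>y $ 2 - \<mu> * b\<bar>"
        "infnorm \<gamma> \<le> Q j * (4 * real_of_int (q (Suc k)) + q k * \<bar>\<mu>\<bar> / e)"
      by blast
    have E: "infnorm (\<gamma> *v x - y) \<le> 2 * real_of_int (Q j) * e + Y / (real_of_int (Q j) * Q (Suc j))"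
      using \<gamma>(3) err by linarith
    have e: "0 < e" "q (Suc k) * e \<le> X" "X \<le> 2 * (q (Suc k) * e)"
      using D(5,7) approx_seq_gap_lower[OF uv, of k] by (simp_all only: e_def q_def X_def infnorm_vec2)
    have q: "0 \<le> q k" "q k \<le> q (Suc k)" using D(3,4) unfolding q_def by simp_all
    have "infnorm (\<gamma> *v x - y) ^ 3 * infnorm \<gamma> \<le> 184 * X * Y ^ 2"
      by (rule irrational_target_estimate[OF infnorm_pos_le E infnorm_pos_le \<gamma>(4) e(2,3) _ _ _ _ _ _ c])
        (use q e \<mu>(1) Q(1) XY in auto)
    also have "\<dots> \<le> (7 * sqrt 5) ^ 3 * X * Y ^ 2"
    proof -
      have "184 \<le> 7 ^ 3 * (1 :: real)" by simp
      also have "\<dots> \<le> 7 ^ 3 * sqrt 5 ^ 3" by (intro mult_left_mono one_le_power) simp_all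
      finally have "184 \<le> (7 * sqrt 5) ^ 3" by (simp only: power_mult_distrib)
      then show ?thesis using XY by (intro mult_right_mono) auto
    qed
    finally have "infnorm (\<gamma> *v x - y)
        \<le> (7 * sqrt 5 * X powr (1/3) * Y powr (2/3)) / infnorm \<gamma> powr (1/3)"
      by (rule le_of_cube_mult_le) (use infnorm_SL2Z_pos[OF \<gamma>(1)] XY in auto)
    \<comment> \<open>Both errors are of order \<open>Y / Q j\<close>: interlacing gives
      \<open>Q j * e \<le> Y / Q j\<close>, which counts twice, and the error of the multiple is at
      most \<open>Y / Q j\<close>.\<close>
    moreover have "infnorm (\<gamma> *v x - y) < \<eta>"
    proof -
      have "X * (real_of_int (Q j) ^ 3 * e) \<le> X * Y"
      proof -
        have "X * real_of_int (Q j) ^ 3 * e \<le> Y * q (Suc k) * e" using c(2) e by (intro mult_right_mono) auto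
        also have "\<dots> \<le> Y * X" using e XY by (simp add: mult.assoc)
        finally show ?thesis by (simp add: mult_ac)
      qed
      then have "real_of_int (Q j) ^ 3 * e \<le> Y" using XY by simp
      moreover have "real_of_int (Q j) ^ 2 * e \<le> real_of_int (Q j) ^ 3 * e"
        using Q(1)[of j] e(1) by (intro mult_right_mono power_increasing) auto
      ultimately have "Q j * e \<le> Y / Q j"
        using Q(1)[of j] by (simp add: field_simps power2_eq_square)
      moreover have "Y / (real_of_int (Q j) * Q (Suc j)) \<le> Y / Q j"
        using Q(1)[of j] Q(1)[of "Suc j"] XY by (intro divide_left_mono) (auto simp: mult_le_cancel_left1)
      ultimately have "infnorm (\<gamma> *v x - y) \<le> 3 * Y / Q j" using E by simp
      also have "\<dots> < \<eta>"
      proof -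
        have "real j0 \<le> Q j" using jk(1) Q(2)[of j] by linarith
        then have "3 * Y / \<eta> < Q j" using j0 by linarith
        then show ?thesis using \<open>\<eta> > 0\<close> Q(1)[of j] by (simp add: field_simps)
      qed
      finally show ?thesis .
    qed
    ultimately show "\<exists>\<gamma>\<in>{\<gamma> \<in> SL2Z. infnorm (\<gamma> *v x - y)
            \<le> (7 * sqrt 5 * infnorm x powr (1/3) * infnorm y powr (2/3)) / infnorm \<gamma> powr (1/3)}.
        \<gamma> *v x \<noteq> y \<and> infnorm (\<gamma> *v x - y) < \<eta>"
      using \<gamma> by (intro bexI[of _ \<gamma>]) (auto simp: X_def Y_def)
  qed
qed

theorem theorem1:
  fixes x :: "real^2"
  assumes "irrational_slope x"
  shows
    "infinite {\<gamma> \<in> SL2Z. infnorm (\<gamma> *v x) \<le> infnorm x / infnorm \<gamma>}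
     \<and> (\<forall>(y :: real^2) (a :: int) (b :: int).
          y \<noteq> 0 \<longrightarrow>
          (y $ 2 \<noteq> 0 \<and> b \<noteq> 0 \<and> slope y = of_int a / of_int b) \<or> (y $ 2 = 0 \<and> a = 1 \<and> b = 0) \<longrightarrow>
          infinite {\<gamma> \<in> SL2Z. infnorm (\<gamma> *v x - y)
            \<le> (2 * sqrt 3 * of_int (max \<bar>a\<bar> \<bar>b\<bar>) * infnorm x powr (1/2) * infnorm y powr (1/2))
               / infnorm \<gamma> powr (1/2)})
     \<and> (\<forall>y :: real^2.
          irrational_slope y \<longrightarrow>
          infinite {\<gamma> \<in> SL2Z. infnorm (\<gamma> *v x - y)
            \<le> (7 * sqrt 5 * infnorm x powr (1/3) * infnorm y powr (2/3))
               / infnorm \<gamma> powr (1/3)})"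
  using infinite_contracting[OF assms] infinite_approximants_rational[OF assms]
    infinite_approximants_irrational[OF assms] by blast

end
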